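(* Let $q$ be an odd prime power, let $F$ be an algebraic closure of $\mathbb{F}_2$, and let $\phi:F^E\to F^E$ be the $FH$-homomorphism with $\phi(\mathbf{x}_{\mathbf{P}})=\sum_{\mathbf{Q}\in\mathbf{P}^\perp\cap E}\mathbf{x}_{\mathbf{Q}}$ for all $\mathbf{P}\in E$. Then, as $FH$-modules, $$F^E=\mathrm{Im}(\phi)\oplus\mathrm{Ker}(\phi).$$
   Context: $PG(2,q)$ is the projective plane over $\mathbb{F}_q$ with homogeneous coordinates; the point $(a_0,a_1,a_2)$ lies on the line $[b_0,b_1,b_2]$ iff $a_0b_0+a_1b_1+a_2b_2=0$. $\mathcal{O}=\{(1,t,t^2)\mid t\in\mathbb{F}_q\}\cup\{(0,0,1)\}$ is the conic $X_1^2-X_0X_2=0$. A line is tangent if it meets $\mathcal{O}$ in exactly one point; a point is external if it lies on exactly two tangent lines. $E$ is the set of external points. $\perp$ is the polarity sending the point $(x,y,z)$ to the line $(x,y,z)^\perp=[z,-2y,x]$. $H\cong PSL(2,q)$ is the group of matrices $\begin{pmatrix}a^2&ab&b^2\\2ac&ad+bc&2bd\\c^2&cd&d^2\end{pmatrix}$ with $a,b,c,d\in\mathbb{F}_q$, $ad-bc=1$, acting on points (row vectors) by right multiplication, $\mathbf{P}\mapsto\mathbf{P}^h$; it preserves $\mathcal{O}$ and acts transitively on $E$. $F^E$ is the $FH$-permutation module with basis $\{\mathbf{x}_{\mathbf{P}}\mid\mathbf{P}\in E\}$, $h\in H$ sending $\mathbf{x}_{\mathbf{P}}$ to $\mathbf{x}_{\mathbf{P}^h}$.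 *)

theory Defs
  imports
    "HOL-Analysis.Analysis"
    "HOL-Algebra.Algebraic_Closure_Type"
begin

unbundle no Formal_Power_Series.fps_syntax

section \<open>The projective plane over a finite field\<close>

definition proportional :: "'k::field ^ 3 \<Rightarrow> 'k ^ 3 \<Rightarrow> bool" where
  "proportional v w \<longleftrightarrow> v \<noteq> 0 \<and> (\<exists>c. c \<noteq> 0 \<and> w = c *s v)"

lemma part_equivp_proportional: "part_equivp (proportional :: 'k::field ^ 3 \<Rightarrow> _)"
proof (rule part_equivpI)
  show "\<exists>v :: 'k ^ 3. proportional v v"
    by (rule exI[of _ "\<chi> i. 1"]) (auto simp: proportional_def vec_eq_iff intro: exI[of _ 1])
  show "symp (proportional :: 'k ^ 3 \<Rightarrow> _)"
  proof (rule sympI)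
    fix v w :: "'k ^ 3" assume "proportional v w"
    then obtain c where "v \<noteq> 0" "c \<noteq> 0" "w = c *s v" by (auto simp: proportional_def)
    then show "proportional w v"
      by (auto simp: proportional_def vec_eq_iff intro!: exI[of _ "inverse c"])
  qed
  show "transp (proportional :: 'k ^ 3 \<Rightarrow> _)"
  proof (rule transpI)
    fix u v w :: "'k ^ 3" assume "proportional u v" "proportional v w"
    then obtain c d where "u \<noteq> 0" "c \<noteq> 0" "v = c *s u" "d \<noteq> 0" "w = d *s v"
      by (auto simp: proportional_def)
    then show "proportional u w"
      by (auto simp: proportional_def intro!: exI[of _ "d * c"])
  qed
qed

text \<open>
  \<open>pt v\<close> is the point with homogeneous coordinates \<open>v\<close>; it is meaningful for \<open>v \<noteq> 0\<close> only.
\<close>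

quotient_type (overloaded) 'k point = "'k::field ^ 3" / partial: proportional
  morphisms rep_pt pt
  by (rule part_equivp_proportional)

instance point :: (finite_field) finite
proof
  have "(UNIV :: 'a point set) \<subseteq> range pt"
  proof
    fix P :: "'a point"
    have "pt (rep_pt P) = P" by (rule Quotient_abs_rep[OF Quotient_point])
    then show "P \<in> range pt" by (metis rangeI)
  qed
  then show "finite (UNIV :: 'a point set)"
    by (rule finite_subset) simp
qed

lift_definition incident :: "'k::field point \<Rightarrow> 'k ^ 3 \<Rightarrow> bool" is
  "\<lambda>a b. scalar_product a b = 0"
proof -
  fix a a' :: "'k ^ 3"
  assume "proportional a a'"
  then obtain c where c: "c \<noteq> 0" "a' = c *s a" by (auto simp: proportional_def)
  have "scalar_product a' b = c * scalar_product a b" for b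
    by (simp add: scalar_product_def c sum_distrib_left mult.assoc)
  with c show "(\<lambda>b. scalar_product a b = 0) = (\<lambda>b. scalar_product a' b = 0)" by simp
qed

text \<open>\<open>line b\<close> is the line \<open>[b\<^sub>0, b\<^sub>1, b\<^sub>2]\<close>, as the set of its points.\<close>

definition line :: "'k::field ^ 3 \<Rightarrow> 'k point set" where
  "line b = {P. incident P b}"

definition all_lines :: "'k::field point set set" where
  "all_lines = {line b | b. b \<noteq> 0}"


section \<open>The conic, external points and the polarity\<close>

definition conic :: "'k::field point set" where
  "conic = {pt (vector [1, t, t ^ 2]) | t. True} \<union> {pt (vector [0, 0, 1])}"

definition tangent :: "'k::field point set \<Rightarrow> bool" where
  "tangent l \<longleftrightarrow> l \<in> all_lines \<and> card (l \<inter> conic) = 1"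

definition external_points :: "'k::field point set" where
  "external_points = {P. card {l. tangent l \<and> P \<in> l} = 2}"

lift_definition perp :: "'k::field point \<Rightarrow> 'k point set" is
  "\<lambda>v. line (vector [v $ 3, - 2 * v $ 2, v $ 1])"
proof -
  fix v w :: "'k ^ 3"
  assume "proportional v w"
  then obtain c where c: "c \<noteq> 0" "w = c *s v" by (auto simp: proportional_def)
  have eq: "vector [w $ 3, - 2 * w $ 2, w $ 1] = c *s (vector [v $ 3, - 2 * v $ 2, v $ 1] :: 'k ^ 3)"
    by (simp add: vec_eq_iff forall_3 c)
  have "scalar_product a (c *s b) = c * scalar_product a b" for a b :: "'k ^ 3"
    by (simp add: scalar_product_def sum_distrib_left mult.left_commute)
  then have "incident P (c *s b) = incident P b" for P and b :: "'k ^ 3"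
    using c(1) by transfer simp
  then show "line (vector [v $ 3, - 2 * v $ 2, v $ 1]) = line (vector [w $ 3, - 2 * w $ 2, w $ 1])"
    by (simp only: eq line_def)
qed


section \<open>The group and its action on points\<close>

definition H :: "('k::field ^ 3 ^ 3) set" where
  "H = {vector [vector [a ^ 2, a * b, b ^ 2],
                vector [2 * a * c, a * d + b * c, 2 * b * d],
                vector [c ^ 2, c * d, d ^ 2]] | a b c d. a * d - b * c = 1}"

text \<open>
  The action of a matrix on points, as row vectors, from the right. The first branch only makes
  the definition total: it is never taken for an invertible matrix, hence never for one in \<open>H\<close>.
\<close>

lift_definition pt_act :: "'k::field point \<Rightarrow> 'k ^ 3 ^ 3 \<Rightarrow> 'k point" is
  "\<lambda>v A. if v v* A = 0 then v else v v* A"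
proof -
  fix v w :: "'k ^ 3" and A :: "'k ^ 3 ^ 3"
  assume vw: "proportional v w"
  then obtain c where c: "c \<noteq> 0" "w = c *s v" by (auto simp: proportional_def)
  have "w v* A = c *s (v v* A)"
    by (simp add: vec_eq_iff vector_matrix_mult_def c sum_distrib_left mult.assoc)
  with vw c show "proportional (if v v* A = 0 then v else v v* A) (if w v* A = 0 then w else w v* A)"
    by (auto simp: proportional_def)
qed


section \<open>The permutation module\<close>

text \<open>
  An \<open>FH\<close>-module is an \<open>F\<close>-vector space with an \<open>F\<close>-linear action of \<open>H\<close>. All modules here live
  in the permutation module on the set of all points; \<open>F\<^sup>E\<close> is the submodule with basis the
  \<open>xb P\<close> for external \<open>P\<close>.
\<close>

abbreviation xb :: "'k::finite_field point \<Rightarrow> 'f::field ^ 'k point" where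
  "xb P \<equiv> axis P 1"

definition H_act :: "'k::finite_field ^ 3 ^ 3 \<Rightarrow> 'f::field ^ 'k point \<Rightarrow> 'f ^ 'k point" where
  "H_act h v = (\<Sum>P\<in>UNIV. v $ P *s xb (pt_act P h))"

definition FE :: "('f::field ^ 'k::finite_field point) set" where
  "FE = vec.span (xb ` external_points)"

definition FH_submodule :: "('f::field ^ 'k::finite_field point) set \<Rightarrow> bool" where
  "FH_submodule U \<longleftrightarrow> vec.subspace U \<and> (\<forall>h\<in>H. \<forall>u\<in>U. H_act h u \<in> U)"

definition FH_hom :: "('f::field ^ 'k::finite_field point) set \<Rightarrow> ('f ^ 'k point) set
    \<Rightarrow> ('f ^ 'k point \<Rightarrow> 'f ^ 'k point) \<Rightarrow> bool" where
  "FH_hom M N \<phi> \<longleftrightarrow>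
     (\<forall>u\<in>M. \<phi> u \<in> N) \<and>
     (\<forall>u\<in>M. \<forall>v\<in>M. \<phi> (u + v) = \<phi> u + \<phi> v) \<and>
     (\<forall>c. \<forall>u\<in>M. \<phi> (c *s u) = c *s \<phi> u) \<and>
     (\<forall>h\<in>H. \<forall>u\<in>M. \<phi> (H_act h u) = H_act h (\<phi> u))"

definition FH_direct_sum :: "('f::field ^ 'k::finite_field point) set
    \<Rightarrow> ('f ^ 'k point) set \<Rightarrow> ('f ^ 'k point) set \<Rightarrow> bool" where
  "FH_direct_sum M U W \<longleftrightarrow>
     FH_submodule U \<and> FH_submodule W \<and>
     M = {u + w | u w. u \<in> U \<and> w \<in> W} \<and> U \<inter> W = {0}"


section \<open>Algebraic closures of the field with two elements\<close>

text \<open>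
  The subfield condition in \<^const>\<open>algebraic_closure\<close> makes \<open>{0, 1}\<close> closed under addition, so
  that it is a field with two elements.
\<close>

definition alg_closure_of_F2 :: "'f::field itself \<Rightarrow> bool" where
  "alg_closure_of_F2 _ \<longleftrightarrow> algebraic_closure (ring_of_type_algebra :: 'f ring) {0, 1}"

end

(*
Write A for the 0-1 matrix of phi and P ~ Q if Q lies on the polar of P, and let T be the matrix of
the relation "the line PQ is tangent to the conic". For distinct external P, Q with PQ not tangent, the
reflection in the pole of PQ fixes P and Q, and counting its fixed points shows that the number of
walks P ~ R ~ S ~ Q is odd iff P ~ Q; for P = Q, reversal shows that the number is even. If PQ is
tangent, isometries show that the number is a constant c. Hence A^3 = A + c T modulo 2, and a direct
count gives A T = T. So A^4 + A^3 + A^2 + A = 0 in characteristic 2, that is, X (X + 1)^3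
annihilates A, and since X and (X + 1)^3 are coprime, the module is the direct sum of the kernel and
the image of A.
*)
theory Submission
  imports Defs
begin

text \<open>A tangent line contains its own pole, which lies on the conic, so no reflection belongs
  to it; this is why the parity argument stops at tangent pairs and leaves an undetermined constant
  c there. Its value never matters: A + 1 annihilates T modulo 2, so multiplying A^3 + A = c T by A
  + 1 removes the unknown term. All counting is done at one base point, (0, 1, 0), whose polar and
  two tangents are the coordinate lines; transitivity of \<open>H\<close> on external points carries
  the resulting relation to all of them.\<close>

section \<open>Parity of finite sets carrying an involution\<close>

lemma even_card_involution:
  assumes "finite M" "\<And>x. x \<in> M \<Longrightarrow> f x \<in> M" "\<And>x. x \<in> M \<Longrightarrow> f (f x) = x"
    "\<And>x. x \<in> M \<Longrightarrow> f x \<noteq> x"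
  shows "even (card M)"
  using assms
proof (induction "card M" arbitrary: M rule: less_induct)
  case less
  show ?case
  proof (cases "M = {}")
    case False
    then obtain x where x: "x \<in> M" by auto
    define Y where "Y = M - {x, f x}"
    have cX: "card M = card Y + 2"
    proof -
      have "{x, f x} \<subseteq> M" using x less.prems(2) by auto
      then have "card Y = card M - card {x, f x}" "card {x, f x} \<le> card M"
        unfolding Y_def using less.prems(1) by (simp_all add: card_Diff_subset card_mono)
      moreover have "card {x, f x} = 2" using less.prems(4)[OF x] by (simp add: card_2_iff)
      ultimately show ?thesis by simp
    qed
    have "even (card Y)"
    proof (rule less.hyps)
      show "card Y < card M" using cX by simp
      show "finite Y" using less.prems(1) by (simp add: Y_def)
      show "f y \<in> Y" if "y \<in> Y" for y
        using that x less.prems(2,3) unfolding Y_def by (metis Diff_iff insert_iff singletonD)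
    qed (use less.prems in \<open>auto simp: Y_def\<close>)
    then show ?thesis by (simp add: cX)
  qed simp
qed

text \<open>The elements moved by \<open>f\<close> pair off, so only the fixed ones contribute to
  the parity.\<close>

lemma even_card_fixed_points:
  assumes "finite M" "\<And>x. x \<in> M \<Longrightarrow> f x \<in> M" "\<And>x. x \<in> M \<Longrightarrow> f (f x) = x"
  shows "even (card M) \<longleftrightarrow> even (card {x \<in> M. f x = x})"
proof -
  have "even (card {x \<in> M. f x \<noteq> x})"
    by (rule even_card_involution[of _ f]) (use assms in auto)
  moreover have "card M = card {x \<in> M. f x = x} + card {x \<in> M. f x \<noteq> x}"
    using card_Un_disjoint[of "{x \<in> M. f x = x}" "{x \<in> M. f x \<noteq> x}"] assms(1)
    by (simp add: disjoint_iff Collect_disj_eq[symmetric])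
      (metis (mono_tags, lifting) Collect_cong Collect_mem_eq)
  ultimately show ?thesis by simp
qed

section \<open>Points and lines in coordinates\<close>

lemma proportional_refl: "v \<noteq> 0 \<Longrightarrow> proportional v v"
  by (auto simp: proportional_def intro: exI[of _ 1])

lemma pt_eq_iff:
  assumes "v \<noteq> 0" "w \<noteq> 0"
  shows "pt v = pt w \<longleftrightarrow> (\<exists>c. c \<noteq> 0 \<and> w = c *s v)"
  using Quotient_rel[OF Quotient_point, of v w] proportional_refl[OF assms(1)]
    proportional_refl[OF assms(2)] assms
  by (auto simp: proportional_def)

lemma pt_scale:
  assumes "v \<noteq> 0" "c \<noteq> 0"
  shows "pt (c *s v) = pt v"
  using assms by (metis pt_eq_iff vector_mul_eq_0)

lemma pt_uminus: "v \<noteq> 0 \<Longrightarrow> pt (- v) = pt v"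
  using pt_scale[of v "-1"] by simp

lemma point_cases:
  obtains v where "v \<noteq> 0" "P = pt v"
proof
  have "proportional (rep_pt P) (rep_pt P)"
    by (rule Quotient_rep_reflp[OF Quotient_point])
  then show "rep_pt P \<noteq> 0" by (simp add: proportional_def)
  show "P = pt (rep_pt P)" by (rule Quotient_abs_rep[OF Quotient_point, symmetric])
qed

lemma incident_pt:
  assumes "v \<noteq> 0"
  shows "incident (pt v) b \<longleftrightarrow> v $ 1 * b $ 1 + v $ 2 * b $ 2 + v $ 3 * b $ 3 = 0"
  using incident.abs_eq[OF proportional_refl[OF assms]]
  by (simp add: scalar_product_def sum_3)

lemma mem_line_pt:
  assumes "v \<noteq> 0"
  shows "pt v \<in> line b \<longleftrightarrow> v $ 1 * b $ 1 + v $ 2 * b $ 2 + v $ 3 * b $ 3 = 0"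
  by (simp add: line_def incident_pt[OF assms])

lemma mem_perp_pt:
  assumes "v \<noteq> 0" "w \<noteq> 0"
  shows "pt w \<in> perp (pt v) \<longleftrightarrow> 2 * v $ 2 * w $ 2 = v $ 1 * w $ 3 + v $ 3 * w $ 1"
  by (simp add: perp.abs_eq[OF proportional_refl[OF assms(1)]] mem_line_pt[OF assms(2)]
      algebra_simps eq_neg_iff_add_eq_0) (auto simp: algebra_simps eq_diff_eq)

lemma line_scale: "c \<noteq> 0 \<Longrightarrow> line (c *s b) = line b"
proof -
  assume c: "c \<noteq> 0"
  have "P \<in> line (c *s b) \<longleftrightarrow> P \<in> line b" for P
  proof (cases P rule: point_cases)
    case (1 v)
    have "v $ 1 * (c *s b) $ 1 + v $ 2 * (c *s b) $ 2 + v $ 3 * (c *s b) $ 3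
       = c * (v $ 1 * b $ 1 + v $ 2 * b $ 2 + v $ 3 * b $ 3)"
      by (simp add: algebra_simps)
    with 1 c show ?thesis by (simp add: mem_line_pt)
  qed
  then show ?thesis by blast
qed

lemma vector_3_eq_iff: "v = w \<longleftrightarrow> v $ 1 = w $ 1 \<and> v $ 2 = w $ 2 \<and> v $ 3 = w $ (3::3)"
  by (simp add: vec_eq_iff forall_3)

text \<open>Translation by 1 permutes the field, so comparing the sum of all elements before and
  after gives q = 0 in the field. As q is odd, 2 = 0 would turn this into 1 = 0.\<close>

lemma two_neq_0:
  assumes "odd CARD('k::finite_field)"
  shows "(2::'k) \<noteq> 0"
proof
  assume two: "(2::'k) = 0"
  have "(\<Sum>x\<in>UNIV. x) = (\<Sum>x\<in>UNIV. x + (1::'k))"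
    by (rule sum.reindex_bij_witness[of _ "\<lambda>x. x + 1" "\<lambda>x. x - 1"]) auto
  then have "(of_nat CARD('k) :: 'k) = 0" by (simp add: sum.distrib)
  moreover obtain m where "CARD('k) = 2 * m + 1" using assms by (rule oddE)
  ultimately show False using two by simp
qed

section \<open>External points and the discriminant\<close>

text \<open>The polar of the conic point with parameter \<open>s\<close>, that is, the tangent
  there. \<open>None\<close> is the parameter at infinity, belonging to (0, 0, 1).\<close>

definition ctan :: "'k::field option \<Rightarrow> 'k point set" where
  "ctan s = (case s of None \<Rightarrow> line (vector [1, 0, 0]) | Some t \<Rightarrow> line (vector [t\<^sup>2, - 2 * t, 1]))"

definition cpt :: "'k::field option \<Rightarrow> 'k point" where
  "cpt s = (case s of None \<Rightarrow> pt (vector [0, 0, 1]) | Some t \<Rightarrow> pt (vector [1, t, t\<^sup>2]))"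

lemma conic_eq: "conic = range cpt"
  by (auto simp: conic_def cpt_def image_iff split: option.split)

lemma cpt_nz: "vector [1, t, t\<^sup>2] \<noteq> (0::'k::field^3)" "vector [0, 0, 1] \<noteq> (0::'k::field^3)"
  by (auto simp: vector_3_eq_iff)

lemma inj_cpt: "inj cpt"
  by (rule injI) (auto simp: cpt_def pt_eq_iff cpt_nz vector_3_eq_iff split: option.splits)

lemma cpt_in_line:
  "cpt None \<in> line b \<longleftrightarrow> b $ 3 = 0"
  "cpt (Some t) \<in> line b \<longleftrightarrow> b $ 1 + t * b $ 2 + t\<^sup>2 * b $ 3 = 0"
  by (simp_all add: cpt_def mem_line_pt cpt_nz)

text \<open>Inserting (1, u, u^2) into the tangent at a finite parameter t gives (t - u)^2, which
  vanishes only for u = t.\<close>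

lemma ctan_conic: "ctan s \<inter> conic = {cpt s}"
proof -
  have "cpt r \<in> ctan s \<longleftrightarrow> r = s" for r
  proof -
    have "t\<^sup>2 - u * (2 * t) + u\<^sup>2 = (t - u)\<^sup>2" for t u :: 'a by (simp add: power2_eq_square algebra_simps)
    then show ?thesis
      by (cases r; cases s) (auto simp: ctan_def cpt_in_line)
  qed
  then show ?thesis by (auto simp: conic_eq)
qed

lemma inj_ctan: "inj ctan"
  by (rule injI) (metis ctan_conic inj_cpt injD singleton_inject)

text \<open>Along the conic, the equation of a line is a polynomial of degree at most two in the
  parameter; a single intersection forces a double root, finite or at infinity.\<close>

lemma tangent_eq:
  assumes "(2::'k::field) \<noteq> 0"
  shows "tangent (l :: 'k point set) \<longleftrightarrow> l \<in> range ctan"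
proof
  assume "l \<in> range ctan"
  then obtain s where s: "l = ctan s" by auto
  have "l \<in> all_lines"
    by (auto simp: s ctan_def all_lines_def split: option.split intro!: exI) (auto simp: vector_3_eq_iff)
  then show "tangent l" by (simp add: tangent_def s ctan_conic)
next
  assume "tangent l"
  then obtain b c where b: "b \<noteq> 0" "l = line b" and c: "l \<inter> conic = {c}"
    by (auto simp: tangent_def all_lines_def card_1_singleton_iff)
  from c obtain r where r: "c = cpt r" by (auto simp: conic_eq)
  have mem: "cpt s \<in> line b \<longleftrightarrow> s = r" for s
    using c r inj_cpt by (auto simp: conic_eq b dest: injD)
  show "l \<in> range ctan"
  proof (cases r)
    case None
    have b3: "b $ 3 = 0" using mem[of None] None by (simp add: cpt_in_line)
    have b2: "b $ 2 = 0"
    proof (rule ccontr)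
      assume "b $ 2 \<noteq> 0"
      then have "cpt (Some (- b $ 1 / b $ 2)) \<in> line b" by (simp add: cpt_in_line b3)
      then show False using mem None by simp
    qed
    have *: "b = b $ 1 *s vector [1, 0, 0]" by (simp add: vector_3_eq_iff b2 b3)
    have "b $ 1 \<noteq> 0" using b(1) b2 b3 by (auto simp: vector_3_eq_iff)
    then have "line b = ctan None" by (subst *) (simp add: line_scale ctan_def)
    then show ?thesis using b by simp
  next
    case (Some t)
    have b3: "b $ 3 \<noteq> 0" using mem[of None] Some by (simp add: cpt_in_line)
    have t: "b $ 1 + t * b $ 2 + t\<^sup>2 * b $ 3 = 0" using mem[of "Some t"] Some by (simp add: cpt_in_line)
    \<comment> \<open>The second root by Vieta; it also gives a point of the line, so it must equal
      \<open>t\<close>.\<close>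
    let ?u = "- b $ 2 / b $ 3 - t"
    have "b $ 1 + ?u * b $ 2 + ?u\<^sup>2 * b $ 3 = b $ 1 + t * b $ 2 + t\<^sup>2 * b $ 3"
      using b3 by (simp add: field_simps power2_eq_square)
    then have "cpt (Some ?u) \<in> line b" using t by (simp add: cpt_in_line)
    then have "?u = t" using mem Some by simp
    then have b2: "b $ 2 = b $ 3 * (- 2 * t)" using b3 by (simp add: field_simps) (metis minus_minus)
    then have b1: "b $ 1 = b $ 3 * t\<^sup>2" using t by (simp add: algebra_simps power2_eq_square)
    have *: "b = b $ 3 *s vector [t\<^sup>2, - 2 * t, 1]"
      unfolding vector_3_eq_iff using b1 b2 by simp
    from b3 have "line b = ctan (Some t)" by (subst *) (simp add: line_scale ctan_def)
    then show ?thesis using b by simp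
  qed
qed

text \<open>
  The parameters of the tangents through the point \<open>v\<close> are the projective roots of the quadratic
  form \<open>v\<^sub>1 T\<^sup>2 - 2 v\<^sub>2 T + v\<^sub>3\<close>, whose discriminant is \<open>4 disc v\<close>.
\<close>

definition disc :: "'k::field ^ 3 \<Rightarrow> 'k" where
  "disc v = (v $ 2)\<^sup>2 - v $ 1 * v $ 3"

lemma disc_0 [simp]: "disc 0 = 0"
  by (simp add: disc_def)

lemma disc_scale [simp]: "disc (c *s v) = c\<^sup>2 * disc v"
  by (simp add: disc_def algebra_simps power2_eq_square)

lemma disc_1_nz: "disc v = 1 \<Longrightarrow> v \<noteq> 0"
  by (metis disc_0 zero_neq_one)

text \<open>Tangents may be counted by parameters because \<open>ctan\<close> is injective. The last
  summand accounts for the tangent X_0 = 0 at infinity.\<close>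

lemma card_tangents:
  assumes "(2::'k::finite_field) \<noteq> 0" and v: "v \<noteq> (0 :: 'k ^ 3)"
  shows "card {l. tangent l \<and> pt v \<in> l}
    = card {t. v $ 1 * t\<^sup>2 - 2 * v $ 2 * t + v $ 3 = 0} + (if v $ 1 = 0 then 1 else 0)"
proof -
  let ?R = "{t. v $ 1 * t\<^sup>2 - 2 * v $ 2 * t + v $ 3 = 0}"
  let ?N = "if v $ 1 = 0 then {None} else {}"
  have "{l. tangent l \<and> pt v \<in> l} = ctan ` (Some ` ?R \<union> ?N)"
  proof -
    have "pt v \<in> ctan s \<longleftrightarrow> s \<in> Some ` ?R \<union> ?N" for s
      by (cases s) (auto simp: ctan_def mem_line_pt[OF v] algebra_simps)
    then show ?thesis by (auto simp: tangent_eq[OF assms(1)])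
  qed
  then have "card {l. tangent l \<and> pt v \<in> l} = card (Some ` ?R \<union> ?N)"
    by (simp add: card_image inj_on_subset[OF inj_ctan])
  also have "\<dots> = card (Some ` ?R) + card ?N"
    by (subst card_Un_disjoint) auto
  also have "card (Some ` ?R) = card ?R" by (simp add: card_image)
  also have "card ?N = (if v $ 1 = 0 then 1 else 0)" by simp
  finally show ?thesis .
qed

text \<open>Multiplying by \<open>v $ 1\<close> and completing the square leaves a square to be
  equal to \<open>disc v\<close>, with two solutions exactly for a nonzero square. If
  \<open>v $ 1 = 0\<close>, one root is at infinity, and exactly one finite root exists iff
  \<open>v $ 2\<close> is nonzero; then \<open>disc v\<close> is the square of
  \<open>v $ 2\<close>.\<close>

lemma external_pt_iff:
  assumes two: "(2::'k::finite_field) \<noteq> 0" and v: "v \<noteq> (0 :: 'k ^ 3)"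
  shows "pt v \<in> external_points \<longleftrightarrow> (\<exists>s. s \<noteq> 0 \<and> disc v = s\<^sup>2)"
proof (cases "v $ 1 = 0")
  case x: True
  show ?thesis
  proof (cases "v $ 2 = 0")
    case True
    with x v have "v $ 3 \<noteq> 0" by (auto simp: vector_3_eq_iff)
    with x True show ?thesis
      by (simp add: external_points_def card_tangents[OF two v] disc_def)
  next
    case False
    have "{t. v $ 1 * t\<^sup>2 - 2 * v $ 2 * t + v $ 3 = 0} = {v $ 3 / (2 * v $ 2)}"
      using False x two by (auto simp: field_simps)
    with x False show ?thesis
      by (auto simp: external_points_def card_tangents[OF two v] disc_def)
  qed
next
  case x: False
  have root: "v $ 1 * t\<^sup>2 - 2 * v $ 2 * t + v $ 3 = 0 \<longleftrightarrow> (v $ 1 * t - v $ 2)\<^sup>2 = disc v" for t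
  proof -
    have "(v $ 1 * t - v $ 2)\<^sup>2 - disc v = v $ 1 * (v $ 1 * t\<^sup>2 - 2 * v $ 2 * t + v $ 3)"
      by (simp add: disc_def power2_eq_square algebra_simps)
    then show ?thesis using x by (metis eq_iff_diff_eq_0 mult_eq_0_iff)
  qed
  have ext: "pt v \<in> external_points \<longleftrightarrow> card {t. (v $ 1 * t - v $ 2)\<^sup>2 = disc v} = 2"
    using x by (simp add: external_points_def card_tangents[OF two v] root)
  show ?thesis
  proof
    assume "pt v \<in> external_points"
    then obtain t u where tu: "{t. (v $ 1 * t - v $ 2)\<^sup>2 = disc v} = {t, u}" "t \<noteq> u"
      unfolding ext by (auto simp: card_2_iff)
    then have t: "(v $ 1 * t - v $ 2)\<^sup>2 = disc v" and u: "(v $ 1 * u - v $ 2)\<^sup>2 = disc v" by auto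
    have "v $ 1 * t - v $ 2 \<noteq> 0"
    proof
      assume 0: "v $ 1 * t - v $ 2 = 0"
      with t u have "v $ 1 * u - v $ 2 = 0" by simp
      with 0 x tu(2) show False by (metis eq_iff_diff_eq_0 mult_cancel_left)
    qed
    with t show "\<exists>s. s \<noteq> 0 \<and> disc v = s\<^sup>2" by metis
  next
    assume "\<exists>s. s \<noteq> 0 \<and> disc v = s\<^sup>2"
    then obtain s where s: "s \<noteq> 0" "disc v = s\<^sup>2" by auto
    have "{t. (v $ 1 * t - v $ 2)\<^sup>2 = disc v} = {(v $ 2 + s) / v $ 1, (v $ 2 - s) / v $ 1}"
      using x by (auto simp: s(2) power2_eq_iff field_simps)
    moreover have "(v $ 2 + s) / v $ 1 \<noteq> (v $ 2 - s) / v $ 1"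
    proof
      assume "(v $ 2 + s) / v $ 1 = (v $ 2 - s) / v $ 1"
      then have "2 * s = 0" using x by (simp add: field_simps)
      with two s(1) show False by simp
    qed
    ultimately show "pt v \<in> external_points" by (simp add: ext)
  qed
qed

lemma external_if_disc_1:
  assumes "(2::'k::finite_field) \<noteq> 0" "disc (v :: 'k ^ 3) = 1"
  shows "pt v \<in> external_points"
proof -
  have "v \<noteq> 0" using assms(2) by auto
  then show ?thesis
    using assms(2) by (simp add: external_pt_iff[OF assms(1)] exI[of _ 1])
qed

text \<open>
  Normalising to \<open>disc v = 1\<close> makes the homogeneous coordinates of an external point unique up to
  sign.
\<close>

lemma external_cases:
  assumes two: "(2::'k::finite_field) \<noteq> 0" and P: "P \<in> (external_points :: 'k point set)"
  obtains v where "disc v = 1" "P = pt v"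
proof (cases P rule: point_cases)
  case (1 u)
  then obtain s where s: "s \<noteq> 0" "disc u = s\<^sup>2" using P external_pt_iff[OF two] by auto
  show ?thesis
  proof
    show "disc (inverse s *s u) = 1" using s by (simp add: power_inverse)
    show "P = pt (inverse s *s u)" using 1 s by (simp add: pt_scale)
  qed
qed

lemma pt_eq_iff_disc_1:
  assumes "disc v = 1" "disc w = 1"
  shows "pt v = pt w \<longleftrightarrow> w = v \<or> w = - v"
proof
  have nz: "v \<noteq> 0" "w \<noteq> 0" using assms by (metis disc_0 zero_neq_one)+
  assume "pt v = pt w"
  then obtain c where c: "w = c *s v" using pt_eq_iff[OF nz] by blast
  then have "c\<^sup>2 = 1" using assms by simp
  then have "c = 1 \<or> c = -1" by (simp add: power2_eq_1_iff)
  then show "w = v \<or> w = - v" using c by (metis vector_smult_lid vector_sneg_minus1)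
next
  assume "w = v \<or> w = - v"
  moreover have "v \<noteq> 0" using assms by (metis disc_0 zero_neq_one)
  ultimately show "pt v = pt w" using pt_uminus by metis
qed

section \<open>Isometries\<close>

text \<open>Isometries of the quadratic form of the conic. They include both \<open>H\<close> and
  the reflections \<open>swap_mat\<close>, which have determinant -1.\<close>

definition disc_preserving :: "'k::field ^ 3 ^ 3 \<Rightarrow> bool" where
  "disc_preserving A \<longleftrightarrow> (\<forall>v. disc (v v* A) = disc v)"

lemma vector_matrix_mult_3:
  fixes v :: "'k::field ^ 3"
  shows "(v v* A) $ j = v $ 1 * A $ 1 $ j + v $ 2 * A $ 2 $ j + v $ 3 * A $ 3 $ j"
  by (simp add: vector_matrix_mult_def sum_3 mult.commute)

lemma pt_act_pt:
  assumes "disc_preserving A" "disc v = 1"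
  shows "pt_act (pt v) A = pt (v v* A)"
proof -
  have "v \<noteq> 0" using assms(2) by auto
  moreover have "disc (v v* A) = 1" using assms by (simp add: disc_preserving_def)
  then have "v v* A \<noteq> 0" by auto
  ultimately show ?thesis by (simp add: pt_act.abs_eq proportional_refl)
qed

text \<open>Minus the pairing of \<open>w\<close> with the line coordinates of the polar of
  \<open>v\<close>. By \<open>bil_eq\<close> it is the polar form of \<open>disc\<close>, which is
  why isometries respect the polarity.\<close>

definition bil :: "'k::field ^ 3 \<Rightarrow> 'k ^ 3 \<Rightarrow> 'k" where
  "bil v w = 2 * v $ 2 * w $ 2 - v $ 1 * w $ 3 - v $ 3 * w $ 1"

lemma bil_eq: "bil v w = disc (v + w) - disc v - disc w"
  by (simp add: bil_def disc_def power2_eq_square algebra_simps)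

lemma bil_preserved: "disc_preserving A \<Longrightarrow> bil (v v* A) (w v* A) = bil v w"
  by (simp add: bil_eq disc_preserving_def flip: vector_matrix_left_distrib)

lemma mem_perp_iff_bil:
  assumes "v \<noteq> 0" "w \<noteq> 0"
  shows "pt w \<in> perp (pt v) \<longleftrightarrow> bil v w = 0"
  by (auto simp: mem_perp_pt[OF assms] bil_def algebra_simps)

definition nb :: "'k::field point \<Rightarrow> 'k point set" where
  "nb P = perp P \<inter> external_points"

text \<open>The pair \<open>(R, S)\<close> records P ~ R ~ S ~ Q. Attaching \<open>S\<close> to
  \<open>Q\<close> rather than \<open>Q\<close> to \<open>S\<close> treats both ends alike, so that
  reversal is \<open>prod.swap\<close>.\<close>

definition walks :: "'k::field point \<Rightarrow> 'k point \<Rightarrow> ('k point \<times> 'k point) set" where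
  "walks P Q = {(R, S). R \<in> nb P \<and> S \<in> nb Q \<and> S \<in> perp R}"

text \<open>
  These matrices fix the point \<open>(0, 1, 0)\<close> and exchange its two tangents.
\<close>

definition swap_mat :: "'k::field \<Rightarrow> 'k ^ 3 ^ 3" where
  "swap_mat m = vector [vector [0, 0, inverse m], vector [0, 1, 0], vector [m, 0, 0]]"

lemma swap_mat_mult: "v v* swap_mat m = vector [v $ 3 * m, v $ 2, v $ 1 * inverse m]"
  unfolding vector_3_eq_iff by (simp add: vector_matrix_mult_3 swap_mat_def)

lemma disc_preserving_swap_mat: "m \<noteq> 0 \<Longrightarrow> disc_preserving (swap_mat m)"
  by (simp add: disc_preserving_def swap_mat_mult disc_def)

lemma H_mult:
  assumes "h \<in> H"
  obtains a b c d where "a * d - b * c = 1"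
    "\<And>v. v v* h = vector [a\<^sup>2 * v $ 1 + 2 * a * c * v $ 2 + c\<^sup>2 * v $ 3,
                a * b * v $ 1 + (a * d + b * c) * v $ 2 + c * d * v $ 3,
                b\<^sup>2 * v $ 1 + 2 * b * d * v $ 2 + d\<^sup>2 * v $ 3]"
proof -
  from assms obtain a b c d where "a * d - b * c = 1"
    and h: "h = vector [vector [a ^ 2, a * b, b ^ 2],
                vector [2 * a * c, a * d + b * c, 2 * b * d],
                vector [c ^ 2, c * d, d ^ 2]]"
    unfolding H_def by blast
  then show ?thesis
    by (intro that) (simp_all add: vector_3_eq_iff vector_matrix_mult_3 mult.commute)
qed

text \<open>\<open>h\<close> performs a linear substitution in the binary quadratic form with
  coefficients \<open>v $ 1\<close>, \<open>2 * v $ 2\<close>, \<open>v $ 3\<close>; the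
  discriminant is multiplied by the squared determinant of the substitution, here 1.\<close>

lemma disc_preserving_H:
  assumes "h \<in> H" shows "disc_preserving h"
proof -
  from H_mult[OF assms] obtain a b c d where ad: "a * d - b * c = 1"
    and h: "\<And>v. v v* h = vector [a\<^sup>2 * v $ 1 + 2 * a * c * v $ 2 + c\<^sup>2 * v $ 3,
                a * b * v $ 1 + (a * d + b * c) * v $ 2 + c * d * v $ 3,
                b\<^sup>2 * v $ 1 + 2 * b * d * v $ 2 + d\<^sup>2 * v $ 3]" by metis
  have "disc (v v* h) = (a * d - b * c)\<^sup>2 * disc v" for v
    by (simp add: h disc_def power2_eq_square algebra_simps)
  then show ?thesis by (simp add: disc_preserving_def ad)
qed

lemma perp_irrefl:
  assumes "(2::'k::finite_field) \<noteq> 0" and "P \<in> (external_points :: 'k point set)"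
  shows "P \<notin> perp P"
proof -
  obtain v where v: "disc v = 1" "P = pt v" using external_cases[OF assms] .
  then have "v \<noteq> 0" by auto
  moreover have "bil v v = 2 * disc v" by (simp add: bil_def disc_def power2_eq_square algebra_simps)
  ultimately show ?thesis using v assms(1) by (simp add: mem_perp_iff_bil)
qed

lemma perp_sym:
  shows "P \<in> perp Q \<longleftrightarrow> Q \<in> perp P"
proof -
  obtain v where v: "v \<noteq> 0" "P = pt v" by (rule point_cases)
  obtain w where w: "w \<noteq> 0" "Q = pt w" by (rule point_cases)
  have "bil v w = bil w v" by (simp add: bil_def)
  then show ?thesis by (simp add: v w mem_perp_iff_bil)
qed

context
  assumes two: "(2::'k::finite_field) \<noteq> 0"
begin

lemma external_pt_act:
  assumes "disc_preserving A" "P \<in> (external_points :: 'k point set)"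
  shows "pt_act P A \<in> external_points"
proof -
  obtain v where v: "disc v = 1" "P = pt v" using external_cases[OF two assms(2)] .
  with assms(1) show ?thesis
    by (simp add: pt_act_pt external_if_disc_1[OF two] disc_preserving_def)
qed

lemma perp_pt_act:
  assumes A: "disc_preserving A" and P: "P \<in> (external_points :: 'k point set)" and Q: "Q \<in> external_points"
  shows "pt_act Q A \<in> perp (pt_act P A) \<longleftrightarrow> Q \<in> perp P"
proof -
  obtain v where v: "disc v = 1" "P = pt v" using external_cases[OF two P] .
  obtain w where w: "disc w = 1" "Q = pt w" using external_cases[OF two Q] .
  have "disc (v v* A) = 1" "disc (w v* A) = 1" using A v w by (simp_all add: disc_preserving_def)
  then have "v \<noteq> 0" "w \<noteq> 0" "v v* A \<noteq> 0" "w v* A \<noteq> 0" using v w by auto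
  then show ?thesis
    by (simp add: v w A pt_act_pt mem_perp_iff_bil bil_preserved)
qed

lemma swap_swap:
  assumes "m \<noteq> 0" "P \<in> (external_points :: 'k point set)"
  shows "pt_act (pt_act P (swap_mat m)) (swap_mat m) = P"
proof -
  obtain v where v: "disc v = 1" "P = pt v" using external_cases[OF two assms(2)] .
  have "v v* swap_mat m v* swap_mat m = v"
    using assms(1) unfolding vector_3_eq_iff by (simp add: swap_mat_mult)
  moreover have "disc (v v* swap_mat m) = 1"
    using disc_preserving_swap_mat[OF assms(1)] v by (simp add: disc_preserving_def)
  ultimately show ?thesis
    using v by (simp add: pt_act_pt disc_preserving_swap_mat assms(1))
qed

lemma swap_walks:
  assumes m: "m \<noteq> 0" and P: "P \<in> (external_points :: 'k point set)" "Q \<in> external_points"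
    and p: "p \<in> walks P Q"
  defines "s \<equiv> \<lambda>R. pt_act R (swap_mat m)"
  shows "map_prod s s p \<in> walks (s P) (s Q)"
  using p P external_pt_act[OF disc_preserving_swap_mat[OF m]] perp_pt_act[OF disc_preserving_swap_mat[OF m]]
  by (auto simp: walks_def nb_def s_def)

text \<open>The reflection injects walks into walks between the image points. Being an involution,
  it also injects them back, which gives the other inequality.\<close>

lemma card_walks_swap:
  assumes m: "m \<noteq> 0" and P: "P \<in> (external_points :: 'k point set)" "Q \<in> external_points"
  defines "s \<equiv> \<lambda>R. pt_act R (swap_mat m)"
  shows "card (walks (s P) (s Q)) = card (walks P Q)"
proof -
  have le: "card (walks P Q) \<le> card (walks (s P) (s Q))"
    if "P \<in> (external_points :: 'k point set)" "Q \<in> external_points" for P Q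
  proof (rule card_inj_on_le[of "map_prod s s"])
    show "inj_on (map_prod s s) (walks P Q)"
      by (rule inj_on_inverseI[of _ "map_prod s s"])
        (auto simp: walks_def nb_def s_def swap_swap[OF m])
    show "map_prod s s ` walks P Q \<subseteq> walks (s P) (s Q)"
      using swap_walks[OF m that] by (auto simp: s_def)
  qed simp
  have "s P \<in> external_points" "s Q \<in> external_points"
    using P external_pt_act[OF disc_preserving_swap_mat[OF m]] by (auto simp: s_def)
  from le[OF P] le[OF this] show ?thesis using P by (simp add: s_def swap_swap[OF m])
qed

end

section \<open>Counting walks modulo two\<close>

text \<open>The common point of the tangents X_0 = 0 and X_2 = 0, with polar X_1 = 0, so that its
  relations to other points become vanishing of coordinates.\<close>

definition P0 :: "'k::field point" where
  "P0 = pt (vector [0, 1, 0])"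

text \<open>The row of T at \<open>P0\<close>. Of the two tangents through \<open>P0\<close>, only
  \<open>P0\<close> itself and the two points of contact are left out.\<close>

definition tan0 :: "'k::field point set" where
  "tan0 = {pt (vector [x, 1, 0]) | x. x \<noteq> 0} \<union> {pt (vector [0, 1, z]) | z. z \<noteq> 0}"

text \<open>With \<open>disc v = 1\<close>, a vanishing outer coordinate forces the middle one to be
  1 or -1. Both outer coordinates vanish for \<open>P0\<close> only; neither vanishes when the line
  to \<open>P0\<close> is not tangent.\<close>

lemma pt_mem_tan0_iff:
  fixes v :: "'k::field ^ 3"
  assumes v: "disc v = 1"
  shows "pt v \<in> tan0 \<longleftrightarrow> (v $ 1 = 0) \<noteq> (v $ 3 = 0)"
proof
  assume "pt v \<in> tan0"
  then obtain x z where xz: "pt v = pt (vector [x, 1, z])" "(x = 0) \<noteq> (z = 0)"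
    unfolding tan0_def by auto
  then have "disc (vector [x, 1, z]) = 1" by (auto simp: disc_def)
  from pt_eq_iff_disc_1[OF v this] xz(1)
  have "vector [x, 1, z] = v \<or> vector [x, 1, z] = - v" by simp
  with xz(2) show "(v $ 1 = 0) \<noteq> (v $ 3 = 0)" unfolding vector_3_eq_iff by auto
next
  assume *: "(v $ 1 = 0) \<noteq> (v $ 3 = 0)"
  then have "(v $ 2)\<^sup>2 = 1" using v by (auto simp: disc_def)
  then have y: "v $ 2 = 1 \<or> v $ 2 = -1" by (simp add: power2_eq_1_iff)
  \<comment> \<open>\<open>v $ 2\<close> is its own inverse, so this scaling makes the middle
    coordinate 1.\<close>
  have "pt v = pt (v $ 2 *s v)" using pt_scale[of v "v $ 2"] disc_1_nz[OF v] y by auto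
  moreover have "v $ 2 *s v = vector [v $ 2 * v $ 1, 1, v $ 2 * v $ 3]"
    using y unfolding vector_3_eq_iff by auto
  ultimately have pt: "pt v = pt (vector [v $ 2 * v $ 1, 1, v $ 2 * v $ 3])" by simp
  show "pt v \<in> tan0"
  proof (cases "v $ 1 = 0")
    case True
    then have "v $ 2 * v $ 3 \<noteq> 0" using * y by auto
    with pt True show ?thesis unfolding tan0_def by auto
  next
    case False
    then have "v $ 3 = 0" "v $ 2 * v $ 1 \<noteq> 0" using * y by auto
    with pt show ?thesis unfolding tan0_def by auto
  qed
qed

context
  assumes two: "(2::'k::finite_field) \<noteq> 0"
begin

lemma P0_external: "P0 \<in> (external_points :: 'k point set)"
  by (simp add: P0_def external_if_disc_1[OF two] disc_def)

lemma tan0_external: "tan0 \<subseteq> (external_points :: 'k point set)"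
  by (auto simp: tan0_def external_if_disc_1[OF two] disc_def)

lemma mem_perp_disc_1:
  assumes "disc (v :: 'k ^ 3) = 1" "disc w = 1"
  shows "pt w \<in> perp (pt v) \<longleftrightarrow> bil v w = 0"
  using assms disc_1_nz mem_perp_iff_bil by metis

lemma mem_perp_P0:
  assumes "w \<noteq> 0"
  shows "pt w \<in> perp P0 \<longleftrightarrow> w $ 2 = (0::'k)"
proof -
  have "(vector [0, 1, 0] :: 'k ^ 3) \<noteq> 0" by (simp add: vector_3_eq_iff)
  then show ?thesis using assms two by (simp add: P0_def mem_perp_iff_bil bil_def)
qed

lemma swap_P0: "m \<noteq> 0 \<Longrightarrow> pt_act P0 (swap_mat m) = (P0 :: 'k point)"
proof -
  assume m: "m \<noteq> 0"
  have "disc (vector [0, 1, 0] :: 'k ^ 3) = 1" by (simp add: disc_def)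
  from pt_act_pt[OF disc_preserving_swap_mat[OF m] this] show ?thesis
    by (simp add: P0_def swap_mat_mult)
qed

text \<open>Reversal fixes no walk: \<open>R = S\<close> would put an external point on its own
  polar.\<close>

lemma even_walks_refl:
  assumes "P \<in> (external_points :: 'k point set)"
  shows "even (card (walks P P))"
proof (rule even_card_involution[of _ prod.swap])
  fix p assume "p \<in> walks P P"
  then obtain R S where p: "p = (R, S)" and RS: "R \<in> nb P" "S \<in> nb P" "S \<in> perp R"
    by (auto simp: walks_def)
  have "R \<in> perp S" using RS(3) perp_sym by metis
  then show "prod.swap p \<in> walks P P" using RS by (simp add: walks_def p)
  have "S \<noteq> R" using perp_irrefl[OF two, of R] RS by (auto simp: nb_def)
  then show "prod.swap p \<noteq> p" by (simp add: p)
qed simp_all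

text \<open>\<open>swap_mat (x / z)\<close> fixes \<open>P0\<close> and sends (0, 1, z) to (x, 1,
  0). This compares any two points on different tangents; points on the same tangent are compared
  through one on the other.\<close>

lemma card_walks_tan0:
  assumes "Q \<in> (tan0 :: 'k point set)"
  shows "card (walks P0 Q) = card (walks P0 (pt (vector [1, 1, 0]) :: 'k point))"
proof -
  have a: "card (walks P0 (pt (vector [x, 1, 0]))) = card (walks P0 (pt (vector [0, 1, z]) :: 'k point))"
    if "x \<noteq> 0" "z \<noteq> 0" for x z :: 'k
  proof -
    have m: "x / z \<noteq> 0" using that by simp
    have d: "disc (vector [0, 1, z] :: 'k ^ 3) = 1" by (simp add: disc_def)
    have "pt_act (pt (vector [0, 1, z])) (swap_mat (x / z)) = pt (vector [x, 1, 0])"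
      using that by (simp add: pt_act_pt[OF disc_preserving_swap_mat[OF m] d] swap_mat_mult)
    then show ?thesis
      using card_walks_swap[OF two m P0_external external_if_disc_1[OF two d]] swap_P0[OF m]
      by simp
  qed
  from assms consider x where "x \<noteq> 0" "Q = pt (vector [x, 1, 0])" | z where "z \<noteq> 0" "Q = pt (vector [0, 1, z])"
    unfolding tan0_def by blast
  then show ?thesis
  proof cases
    case 1
    then show ?thesis using a[OF 1(1), of 1] a[of 1 1] by simp
  next
    case 2
    then show ?thesis using a[of 1 z] by simp
  qed
qed

text \<open>
  The \<open>swap_mat\<close> fixing both \<open>P0\<close> and \<open>w\<close> permutes the walks. On the line through \<open>P0\<close> and \<open>w\<close> let
  \<open>T'\<close>, \<open>T\<close> be the points perpendicular to \<open>P0\<close>, \<open>w\<close>, and let \<open>U\<close> be the pole of this line. The fixed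
  walks are \<open>(T', U)\<close> and \<open>(U, T)\<close>, which occur together or not at all because \<open>T'\<close> and \<open>T\<close> have the
  same discriminant, and, exactly if \<open>P0\<close> and \<open>w\<close> are perpendicular, also \<open>(T', T)\<close>.
\<close>

lemma odd_walks:
  assumes w: "disc (w :: 'k ^ 3) = 1" and xz: "w $ 1 \<noteq> 0" "w $ 3 \<noteq> 0"
  shows "odd (card (walks P0 (pt w))) \<longleftrightarrow> w $ 2 = 0"
proof -
  define x y z where "x = w $ 1" and "y = w $ 2" and "z = w $ 3"
  have nz: "x \<noteq> 0" "z \<noteq> 0" using xz by (auto simp: x_def z_def)
  have yy: "y\<^sup>2 = 1 + x * z" using w by (simp add: disc_def x_def y_def z_def algebra_simps)
  \<comment> \<open>The value for which \<open>swap_mat m\<close> fixes \<open>w\<close>: it demands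
    \<open>z * m = x\<close>.\<close>
  define m where "m = x / z"
  have m: "m \<noteq> 0" using nz by (simp add: m_def)
  define s where "s R = pt_act R (swap_mat m)" for R
  \<comment> \<open>With e = (0, 1, 0), \<open>T'\<close> is w - y e and \<open>T\<close> is y w -
    e, where y^2 - 1 has been replaced by x z.\<close>
  define T' where "T' = (vector [x, 0, z] :: 'k ^ 3)"
  define U where "U = (vector [x, 0, - z] :: 'k ^ 3)"
  define T where "T = (vector [x * y, x * z, y * z] :: 'k ^ 3)"
  have TU_nz: "T' \<noteq> 0" "U \<noteq> 0" "T \<noteq> 0" "w \<noteq> 0"
    using nz xz by (auto simp: T'_def U_def T_def vector_3_eq_iff)
  have T_ext: "pt T \<in> external_points \<longleftrightarrow> pt T' \<in> external_points"
  proof -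
    have "disc T = x * z * (x * z - y\<^sup>2)" by (simp add: disc_def T_def power2_eq_square algebra_simps)
    then have "disc T = disc T'" by (simp add: yy disc_def T'_def)
    then show ?thesis by (simp add: external_pt_iff[OF two] TU_nz)
  qed
  have dist: "pt T' \<noteq> pt U" "pt U \<noteq> pt T"
  proof -
    show "pt U \<noteq> pt T" using nz TU_nz by (auto simp: pt_eq_iff U_def T_def vector_3_eq_iff)
    show "pt T' \<noteq> pt U"
    proof
      assume "pt T' = pt U"
      then obtain c where "x = c * x" "- z = c * z"
        using TU_nz by (auto simp: pt_eq_iff U_def T'_def vector_3_eq_iff)
      then have "- z = z" using nz by simp
      then have "2 * z = 0" by (metis add.left_inverse mult_2)
      with two nz show False by simp
    qed
  qed
  have w_ext: "pt w \<in> external_points" using external_if_disc_1[OF two w] .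
  have s_pt: "s (pt v) = pt (v v* swap_mat m)" if "v \<noteq> 0" "pt v \<in> external_points" for v
  proof -
    have "v v* swap_mat m \<noteq> 0"
      using that m unfolding vector_3_eq_iff by (auto simp: swap_mat_mult)
    then show ?thesis using that by (simp add: s_def pt_act.abs_eq proportional_refl)
  qed
  have fixT: "s (pt T') = pt T'" if "pt T' \<in> external_points"
    using s_pt[OF _ that] TU_nz nz by (simp add: swap_mat_mult T'_def m_def)
  have fixT2: "s (pt T) = pt T" if "pt T \<in> external_points"
    using s_pt[OF _ that] TU_nz nz by (simp add: swap_mat_mult T_def m_def mult.commute)
  have fixU: "s (pt U) = pt U" if "pt U \<in> external_points"
  proof -
    have "U v* swap_mat m = - U"
      using nz unfolding vector_3_eq_iff by (simp add: swap_mat_mult U_def m_def)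
    then show ?thesis using s_pt[OF _ that] TU_nz by (simp add: pt_uminus)
  qed
  have fixw: "s (pt w) = pt w"
  proof -
    have "w v* swap_mat m = w"
      using nz unfolding vector_3_eq_iff by (simp add: swap_mat_mult m_def x_def z_def)
    then show ?thesis using pt_act_pt[OF disc_preserving_swap_mat[OF m] w] by (simp add: s_def)
  qed
  \<comment> \<open>A fixed point comes from an eigenvector. Eigenvalue -1 gives the centre
    \<open>U\<close>; eigenvalue 1 gives the axis through \<open>P0\<close> and \<open>w\<close>, on
    which perpendicularity to \<open>P0\<close> or \<open>w\<close> leaves \<open>T'\<close> or
    \<open>T\<close>.\<close>
  have s_fix: "pt r = pt T' \<or> pt r = pt U \<or> pt r = pt T"
    if r: "disc r = 1" "s (pt r) = pt r" and per: "r $ 2 = 0 \<or> bil w r = 0" for r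
  proof -
    have "disc (r v* swap_mat m) = 1"
      using disc_preserving_swap_mat[OF m] r(1) by (simp add: disc_preserving_def)
    moreover have "pt (r v* swap_mat m) = pt r"
      using r pt_act_pt[OF disc_preserving_swap_mat[OF m]] by (simp add: s_def)
    ultimately have "r = r v* swap_mat m \<or> r = - (r v* swap_mat m)"
      using pt_eq_iff_disc_1 r(1) by metis
    then have "r $ 1 = r $ 3 * m \<or> (r $ 1 = - (r $ 3 * m) \<and> r $ 2 = - r $ 2)"
      unfolding vector_3_eq_iff by (auto simp: swap_mat_mult)
    then consider "r $ 1 = r $ 3 * m" | "r $ 1 = - (r $ 3 * m)" "r $ 2 = 0"
      using two by (metis add_eq_0_iff mult_2 mult_eq_0_iff)
    then show ?thesis
    proof cases
      case 2
      then have eq: "r = (- r $ 3 / z) *s U"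
        using nz unfolding vector_3_eq_iff by (simp add: U_def m_def)
      moreover have "- r $ 3 / z \<noteq> 0" using eq r(1) by (metis disc_0 vector_smult_lzero zero_neq_one)
      ultimately show ?thesis using pt_scale TU_nz by metis
    next
      case 1
      show ?thesis
      proof (cases "r $ 2 = 0")
        case True
        with 1 have eq: "r = (r $ 3 / z) *s T'"
          using nz unfolding vector_3_eq_iff by (simp add: T'_def m_def)
        moreover have "r $ 3 / z \<noteq> 0" using eq r(1) by (metis disc_0 vector_smult_lzero zero_neq_one)
        ultimately show ?thesis using pt_scale TU_nz by metis
      next
        case False
        with per have "2 * (y * r $ 2) = 2 * (x * r $ 3)"
          using nz 1 by (simp add: bil_def x_def[symmetric] y_def[symmetric] z_def[symmetric] m_def field_simps)
        then have "y * r $ 2 = x * r $ 3" using two by simp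
        then have "r $ 3 = y * r $ 2 / x" using nz by (simp add: field_simps)
        with 1 have "r = (r $ 2 / (x * z)) *s T"
          using nz unfolding vector_3_eq_iff by (simp add: T_def m_def)
        moreover have "r $ 2 / (x * z) \<noteq> 0" using False nz by simp
        ultimately show ?thesis using pt_scale TU_nz by metis
      qed
    qed
  qed
  have perps: "pt T' \<in> perp P0" "pt U \<in> perp P0" "pt T \<notin> perp P0"
      "pt U \<in> perp (pt w)" "pt T \<in> perp (pt w)" "pt T' \<notin> perp (pt w)"
      "pt U \<in> perp (pt T')" "pt T \<in> perp (pt U)" "pt T \<in> perp (pt T') \<longleftrightarrow> y = 0"
      "pt U \<notin> perp (pt U)"
    using nz two by (simp_all only: mem_perp_P0 mem_perp_iff_bil TU_nz not_False_eq_True)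
      (simp_all add: bil_def T'_def U_def T_def x_def[symmetric] y_def[symmetric] z_def[symmetric] algebra_simps)
  have walks_s: "map_prod s s p \<in> walks P0 (pt w)" if "p \<in> walks P0 (pt w)" for p
    using swap_walks[OF two m P0_external w_ext that] fixw swap_P0[OF m] by (simp add: s_def[abs_def])
  have ss: "s (s R) = R" if "R \<in> external_points" for R
    using swap_swap[OF two m that] by (simp add: s_def)
  have "even (card (walks P0 (pt w))) \<longleftrightarrow> even (card {p \<in> walks P0 (pt w). map_prod s s p = p})"
    by (rule even_card_fixed_points) (use walks_s ss in \<open>auto simp: walks_def nb_def\<close>)
  also have "{p \<in> walks P0 (pt w). map_prod s s p = p} =
      (if pt T' \<in> external_points \<and> pt U \<in> external_points then {(pt T', pt U), (pt U, pt T)} else {})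
      \<union> (if y = 0 then {(pt T', pt T)} else {})" (is "?L = ?A \<union> ?B")
  proof (intro subset_antisym subsetI)
    fix p assume "p \<in> ?L"
    then obtain R S where p: "p = (R, S)" and RS: "R \<in> nb P0" "S \<in> nb (pt w)" "S \<in> perp R"
        "s R = R" "s S = S"
      by (auto simp: walks_def)
    have ext: "R \<in> external_points" "S \<in> external_points" using RS by (auto simp: nb_def)
    obtain r where r: "disc r = 1" "R = pt r" using external_cases[OF two ext(1)] .
    obtain t where t: "disc t = 1" "S = pt t" using external_cases[OF two ext(2)] .
    have "r $ 2 = 0" using RS(1) r mem_perp_P0[OF disc_1_nz[OF r(1)]] by (simp add: nb_def)
    then have "R = pt T' \<or> R = pt U \<or> R = pt T" using s_fix[of r] r RS by auto
    then have R: "R = pt T' \<or> R = pt U" using perps RS(1) by (auto simp: nb_def)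
    have "bil w t = 0" using RS(2) t mem_perp_disc_1[OF w t(1)] by (simp add: nb_def)
    then have "S = pt T' \<or> S = pt U \<or> S = pt T" using s_fix[of t] t RS by auto
    then have S: "S = pt U \<or> S = pt T" using perps RS(2) by (auto simp: nb_def)
    show "p \<in> ?A \<union> ?B" using R S ext perps RS(3) T_ext p by auto
  next
    fix p assume "p \<in> ?A \<union> ?B"
    \<comment> \<open>For \<open>y = 0\<close>, \<open>T'\<close> is \<open>w\<close> and
      \<open>T\<close> represents \<open>P0\<close>: the extra fixed walk runs back and forth
      between the two end points.\<close>
    moreover have "pt T' \<in> external_points" if "y = 0"
      using that yy by (intro external_if_disc_1[OF two]) (simp add: disc_def T'_def neg_eq_iff_add_eq_0 add.commute)
    ultimately consider "p = (pt T', pt U)" "pt T' \<in> external_points" "pt U \<in> external_points"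
      | "p = (pt U, pt T)" "pt T' \<in> external_points" "pt U \<in> external_points"
      | "p = (pt T', pt T)" "pt T' \<in> external_points" "y = 0"
      by (auto split: if_splits)
    then show "p \<in> ?L"
      by cases (use perps T_ext fixT fixT2 fixU in \<open>auto simp: walks_def nb_def\<close>)
  qed
  \<comment> \<open>The walks in \<open>?A\<close> number 0 or 2, and \<open>(pt T', pt T)\<close>
    is never one of them.\<close>
  also have "even (card (?A \<union> ?B)) \<longleftrightarrow> y \<noteq> 0"
    using dist by (auto simp: card_insert_if)
  finally show ?thesis by (simp add: y_def)
qed

text \<open>The polar of \<open>S\<close> meets each tangent through \<open>P0\<close> in one point,
  which is counted unless it is \<open>P0\<close> (\<open>b = 0\<close>) or the point of contact
  (\<open>g = 0\<close> or \<open>a = 0\<close>). For \<open>b = 0\<close> nothing is counted, and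
  \<open>a * g = -1\<close> keeps \<open>S\<close> out of \<open>tan0\<close>.\<close>

lemma odd_tan0_nb:
  assumes "S \<in> (external_points :: 'k point set)"
  shows "odd (card (nb S \<inter> tan0)) \<longleftrightarrow> S \<in> tan0"
proof -
  obtain v where v: "disc v = 1" "S = pt v" using external_cases[OF two assms] .
  define a b g where "a = v $ 1" and "b = v $ 2" and "g = v $ 3"
  have bb: "b\<^sup>2 = 1 + a * g" using v by (simp add: disc_def a_def b_def g_def algebra_simps)
  have v_eq: "v = vector [a, b, g]" unfolding vector_3_eq_iff by (simp add: a_def b_def g_def)
  have x: "pt (vector [x, 1, 0]) \<in> perp S \<longleftrightarrow> 2 * b = g * x" for x
    using mem_perp_disc_1[OF v(1), of "vector [x, 1, 0]"]
    by (simp add: v(2) disc_def bil_def v_eq)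
  have z: "pt (vector [0, 1, z]) \<in> perp S \<longleftrightarrow> 2 * b = a * z" for z
    using mem_perp_disc_1[OF v(1), of "vector [0, 1, z]"]
    by (simp add: v(2) disc_def bil_def v_eq)
  let ?A = "{pt (vector [x, 1, 0]) | x. x \<noteq> 0 \<and> 2 * b = g * x}"
  let ?B = "{pt (vector [0, 1, z]) | z. z \<noteq> 0 \<and> 2 * b = a * z}"
  have nb: "nb S \<inter> tan0 = ?A \<union> ?B"
    using tan0_external x z by (auto simp: nb_def tan0_def)
  have disj: "?A \<inter> ?B = {}"
    by (auto simp: pt_eq_iff_disc_1 disc_def vector_3_eq_iff)
  \<comment> \<open>In other words, the polar of \<open>S\<close> is neither of the two
    tangents.\<close>
  have ab: "b \<noteq> 0 \<or> a \<noteq> 0" "b \<noteq> 0 \<or> g \<noteq> 0" using bb by auto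
  have solve: "x \<noteq> 0 \<and> 2 * b = h * x \<longleftrightarrow> b \<noteq> 0 \<and> h \<noteq> 0 \<and> x = 2 * b / h"
    if "b \<noteq> 0 \<or> h \<noteq> 0" for x h
    using that two by (cases "h = 0") (auto simp: nonzero_eq_divide_eq mult.commute)
  have A: "?A = (if b \<noteq> 0 \<and> g \<noteq> 0 then {pt (vector [2 * b / g, 1, 0])} else {})"
    unfolding solve[OF ab(2)] by auto
  have B: "?B = (if b \<noteq> 0 \<and> a \<noteq> 0 then {pt (vector [0, 1, 2 * b / a])} else {})"
    unfolding solve[OF ab(1)] by auto
  have card: "card (nb S \<inter> tan0) = (if b \<noteq> 0 \<and> g \<noteq> 0 then 1 else 0) + (if b \<noteq> 0 \<and> a \<noteq> 0 then 1 else 0)"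
    unfolding nb by (subst card_Un_disjoint[OF _ _ disj]) (simp_all add: A B)
  have "S \<in> tan0 \<longleftrightarrow> (a = 0) \<noteq> (g = 0)"
    unfolding v(2) a_def g_def by (rule pt_mem_tan0_iff[OF v(1)])
  then show ?thesis unfolding card using bb by auto
qed

end

section \<open>The polynomial identity\<close>

definition sum_xb :: "'k::finite_field point set \<Rightarrow> 'f::field ^ 'k point" where
  "sum_xb A = (\<Sum>Q\<in>A. xb Q)"

lemma subspace_FE: "vec.subspace (FE :: ('f::field ^ 'k::finite_field point) set)"
  by (simp add: FE_def)

lemma xb_FE: "P \<in> external_points \<Longrightarrow> xb P \<in> FE"
  by (auto simp: FE_def intro: vec.span_base)

lemma sum_xb_FE: "A \<subseteq> external_points \<Longrightarrow> sum_xb A \<in> FE"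
  unfolding sum_xb_def by (rule vec.subspace_sum[OF subspace_FE]) (auto intro: xb_FE)

text \<open>The closure steps carry membership in \<open>FE\<close> because \<open>FH_hom\<close>
  makes the map linear on \<open>FE\<close> only.\<close>

lemma FE_induct [consumes 1, case_names zero add scale xb]:
  fixes u :: "'f::field ^ 'k::finite_field point"
  assumes "u \<in> FE" "Q 0" "\<And>u v. u \<in> FE \<Longrightarrow> v \<in> FE \<Longrightarrow> Q u \<Longrightarrow> Q v \<Longrightarrow> Q (u + v)"
    "\<And>c u. u \<in> FE \<Longrightarrow> Q u \<Longrightarrow> Q (c *s u)" "\<And>P. P \<in> external_points \<Longrightarrow> Q (xb P)"
  shows "Q u"
proof -
  have "vec.subspace {u \<in> FE. Q u}"
    unfolding vec.subspace_def using assms(2-4) subspace_FE[where ?'f = 'f and ?'k = 'k]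
    by (auto simp: vec.subspace_0 vec.subspace_add vec.subspace_scale)
  moreover have "xb ` external_points \<subseteq> {u \<in> FE. Q u}"
    using assms(5) xb_FE by auto
  ultimately have "FE \<subseteq> {u \<in> FE. Q u}"
    unfolding FE_def[symmetric] by (subst FE_def) (rule vec.span_minimal)
  with assms(1) show ?thesis by blast
qed

lemma H_act_xb: "H_act h (xb P) = (xb (pt_act P h) :: 'f::field ^ 'k::finite_field point)"
proof -
  have "H_act h (xb P) = (\<Sum>R\<in>UNIV. if R = P then (xb (pt_act P h) :: 'f ^ 'k point) else 0)"
    unfolding H_act_def by (rule sum.cong) (auto simp: axis_def)
  then show ?thesis by simp
qed

lemma H_act_add: "H_act h (u + v) = H_act h u + H_act h v"
  by (simp add: H_act_def sum.distrib vec.scale_left_distrib)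

lemma H_act_scale: "H_act h (c *s u) = c *s H_act h u"
  by (simp add: H_act_def vec.scale_sum_right)

lemma H_act_0: "H_act h 0 = 0"
  by (simp add: H_act_def)

lemma H_act_FE:
  assumes two: "(2::'k::finite_field) \<noteq> 0" and h: "h \<in> H"
    and u: "u \<in> (FE :: ('f::field ^ 'k point) set)"
  shows "H_act h u \<in> FE"
  using u
proof (induction rule: FE_induct)
  case (xb P)
  then show ?case
    by (simp add: H_act_xb xb_FE external_pt_act[OF two disc_preserving_H[OF h]])
qed (simp_all add: H_act_0 H_act_add H_act_scale subspace_FE vec.subspace_0 vec.subspace_add vec.subspace_scale)

text \<open>\<open>P0\<close> corresponds to the form 2XY, and \<open>h\<close> turns it into 2(aX +
  bY)(cX + dY). So the form of \<open>P\<close>, normalised to discriminant 1, has to be split into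
  linear factors of determinant 1.\<close>

lemma H_transitive:
  assumes two: "(2::'k::finite_field) \<noteq> 0" and P: "P \<in> (external_points :: 'k point set)"
  obtains h where "h \<in> H" "P = pt_act P0 h"
proof -
  have act: "\<exists>h\<in>H. pt (vector [2 * a * c, a * d + b * c, 2 * b * d]) = pt_act P0 h"
    if "a * d - b * c = 1" for a b c d :: 'k
  proof -
    let ?h = "vector [vector [a ^ 2, a * b, b ^ 2],
                vector [2 * a * c, a * d + b * c, 2 * b * d],
                vector [c ^ 2, c * d, d ^ 2]] :: 'k ^ 3 ^ 3"
    have h: "?h \<in> H" using that unfolding H_def by blast
    have "vector [0, 1, 0] v* ?h = vector [2 * a * c, a * d + b * c, 2 * b * d]"
      unfolding vector_3_eq_iff by (simp add: vector_matrix_mult_3)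
    moreover have "disc (vector [0, 1, 0] :: 'k ^ 3) = 1" by (simp add: disc_def)
    ultimately have "pt_act P0 ?h = pt (vector [2 * a * c, a * d + b * c, 2 * b * d])"
      unfolding P0_def using pt_act_pt[OF disc_preserving_H[OF h]] by metis
    with h show ?thesis by metis
  qed
  obtain v where v: "disc v = 1" "P = pt v" using external_cases[OF two P] .
  define x y z where "x = v $ 1" and "y = v $ 2" and "z = v $ 3"
  have yy: "y * y = 1 + x * z"
    using v by (simp add: disc_def x_def y_def z_def algebra_simps power2_eq_square)
  have "\<exists>h\<in>H. P = pt_act P0 h"
  proof (cases "x = 0")
    case False
    \<comment> \<open>From \<open>a * d + b * c = y\<close> and \<open>a * d - b * c = 1\<close>
      follow \<open>a * d = (1 + y) / 2\<close> and \<open>b * c = (y - 1) / 2\<close>; the factors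
      are scaled so that \<open>a = 1\<close>, and then \<open>2 * a * c = x\<close> gives
      \<open>c\<close>.\<close>
    define a b c d where "a = (1::'k)" and "b = (y - 1) / x" and "c = x / 2" and "d = (1 + y) / 2"
    have 1: "2 * a * c = x" and d: "a * d = (1 + y) / 2" and b: "b * c = (y - 1) / 2"
      using two False by (simp_all add: a_def b_def c_def d_def)
    have "a * d - b * c = (1 + 1) / 2" unfolding d b by (simp add: diff_divide_distrib[symmetric])
    then have det: "a * d - b * c = 1" using two by simp
    have "a * d + b * c = (y + y) / 2" unfolding d b by (simp add: add_divide_distrib[symmetric])
    then have 2: "a * d + b * c = y" using two by (simp add: mult_2[symmetric] del: mult_2)
    have "2 * d = 1 + y" using two by (simp add: d_def)
    then have "2 * b * d = b * (1 + y)" by (metis mult.assoc mult.commute)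
    then have "2 * b * d = (y * y - 1) / x" by (simp add: b_def algebra_simps)
    then have 3: "2 * b * d = z" using False by (simp add: yy)
    have "v = vector [2 * a * c, a * d + b * c, 2 * b * d]"
      unfolding 1 2 3 vector_3_eq_iff by (simp add: x_def y_def z_def)
    with act[OF det] v(2) show ?thesis by simp
  next
    case True
    with yy have "y\<^sup>2 = 1" by (simp add: power2_eq_square)
    then have y: "y = 1 \<or> y = -1" by (simp add: power2_eq_1_iff)
    have "y *s v = vector [0, 1, y * z]"
      unfolding vector_3_eq_iff using True yy by (simp add: x_def y_def z_def)
    moreover have "pt (y *s v) = P" using y v(2) by (intro pt_scale[THEN trans] disc_1_nz[OF v(1)]) auto
    \<comment> \<open>The variables are instantiated in the order a, d, b, c in which they occur:
      \<open>a = d = 1\<close>, \<open>b = y * z / 2\<close>, \<open>c = 0\<close>.\<close>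
    ultimately show ?thesis using act[of 1 1 "y * z / 2" 0] two by simp
  qed
  then show ?thesis using that by blast
qed

text \<open>Double counting; it turns iterates of the homomorphism on basis vectors into
  cardinalities.\<close>

lemma sum_sum_xb:
  fixes B :: "'i \<Rightarrow> 'k::finite_field point set"
  assumes "finite I" "\<And>i. i \<in> I \<Longrightarrow> B i \<subseteq> external_points"
  shows "(\<Sum>i\<in>I. sum_xb (B i)) = (\<Sum>Q\<in>external_points. of_nat (card {i \<in> I. Q \<in> B i}) *s (xb Q :: 'f::field ^ 'k point))"
proof -
  have "(\<Sum>i\<in>I. sum_xb (B i)) = (\<Sum>i\<in>I. \<Sum>Q\<in>external_points. if Q \<in> B i then (xb Q :: 'f ^ 'k point) else 0)"
    using assms(2) by (intro sum.cong) (auto simp: sum_xb_def sum.If_cases Int_absorb1 Int_absorb2)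
  also have "\<dots> = (\<Sum>Q\<in>external_points. \<Sum>i\<in>I. if Q \<in> B i then (xb Q :: 'f ^ 'k point) else 0)"
    by (rule sum.swap)
  also have "\<dots> = (\<Sum>Q\<in>external_points. of_nat (card {i \<in> I. Q \<in> B i}) *s (xb Q :: 'f ^ 'k point))"
  proof (rule sum.cong[OF refl])
    fix Q :: "'k point"
    have const: "(\<Sum>i\<in>J. x) = of_nat (card J) *s x" for J :: "'i set" and x :: "'f ^ 'k point"
      by (induction J rule: infinite_finite_induct) (simp_all add: vec.scale_left_distrib del: sum_constant)
    have "(\<Sum>i\<in>I. if Q \<in> B i then (xb Q :: 'f ^ 'k point) else 0) = (\<Sum>i\<in>{i \<in> I. Q \<in> B i}. xb Q)"
      by (rule sum.inter_filter[OF assms(1), symmetric])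
    then show "(\<Sum>i\<in>I. if Q \<in> B i then (xb Q :: 'f ^ 'k point) else 0) = of_nat (card {i \<in> I. Q \<in> B i}) *s xb Q"
      by (simp only: const)
  qed
  finally show ?thesis .
qed

lemma of_nat_char_2:
  assumes "(1::'f::field) + 1 = 0"
  shows "(of_nat n :: 'f) = (if odd n then 1 else 0)"
  by (induction n) (use assms in \<open>auto simp: add.commute\<close>)

lemma vec_double_char_2:
  assumes "(1::'f::field) + 1 = 0"
  shows "v + v = (0 :: 'f ^ 'n)"
proof -
  have "a + a = 0" for a :: 'f using assms by (metis distrib_right mult_1 mult_zero_left)
  then show ?thesis by (simp only: vec_eq_iff vector_add_component zero_index) simp
qed

lemma sum_xb_alt:
  assumes "A \<subseteq> external_points"
  shows "sum_xb A = (\<Sum>Q\<in>external_points. (if Q \<in> A then 1 else 0) *s (xb Q :: 'f::field ^ 'k::finite_field point))"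
proof -
  have "(\<Sum>Q\<in>external_points. (if Q \<in> A then 1 else 0) *s (xb Q :: 'f ^ 'k point))
      = (\<Sum>Q\<in>external_points. if Q \<in> A then xb Q else 0)"
    by (rule sum.cong) auto
  then show ?thesis using assms by (simp add: sum_xb_def sum.If_cases Int_absorb1)
qed

section \<open>Relations satisfied by the homomorphism in characteristic two\<close>

locale polarity_map =
  fixes \<phi> :: "'f::field ^ 'k::finite_field point \<Rightarrow> 'f ^ 'k point"
  assumes two: "(2::'k) \<noteq> 0"
    and char_2: "(1::'f) + 1 = 0"
    and hom: "FH_hom FE FE \<phi>"
    and phi_xb: "P \<in> external_points \<Longrightarrow> \<phi> (xb P) = sum_xb (nb P)"
begin

lemma phi_FE: "u \<in> FE \<Longrightarrow> \<phi> u \<in> FE"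
  and phi_add: "u \<in> FE \<Longrightarrow> v \<in> FE \<Longrightarrow> \<phi> (u + v) = \<phi> u + \<phi> v"
  and phi_scale: "u \<in> FE \<Longrightarrow> \<phi> (c *s u) = c *s \<phi> u"
  and phi_H_act: "u \<in> FE \<Longrightarrow> h \<in> H \<Longrightarrow> \<phi> (H_act h u) = H_act h (\<phi> u)"
  using hom by (auto simp: FH_hom_def)

lemmas FE_closed = subspace_FE[THEN vec.subspace_0] subspace_FE[THEN vec.subspace_add]
  subspace_FE[THEN vec.subspace_scale]

lemma phi_0: "\<phi> 0 = 0"
  using phi_scale[of 0 0] FE_closed(1) by simp

lemma phi_sum:
  assumes "\<And>i. i \<in> I \<Longrightarrow> f i \<in> FE"
  shows "\<phi> (sum f I) = (\<Sum>i\<in>I. \<phi> (f i))"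
  using assms
proof (induction I rule: infinite_finite_induct)
  case (insert i I)
  then have "sum f I \<in> FE" by (intro vec.subspace_sum[OF subspace_FE]) auto
  with insert show ?case by (simp add: phi_add)
qed (simp_all add: phi_0)

lemma nb_external: "nb P \<subseteq> external_points"
  by (auto simp: nb_def)

lemma phi_sum_xb:
  assumes "A \<subseteq> external_points"
  shows "\<phi> (sum_xb A) = (\<Sum>P\<in>A. sum_xb (nb P))"
proof -
  have "\<phi> (sum_xb A) = (\<Sum>P\<in>A. \<phi> (xb P))"
    unfolding sum_xb_def using assms by (intro phi_sum xb_FE) auto
  also have "\<dots> = (\<Sum>P\<in>A. sum_xb (nb P))"
    using assms by (intro sum.cong phi_xb) auto
  finally show ?thesis .
qed

lemma phi_tan0: "\<phi> (sum_xb tan0) = sum_xb tan0"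
proof -
  have "\<phi> (sum_xb tan0) = (\<Sum>Q\<in>external_points. of_nat (card {P \<in> tan0. Q \<in> nb P}) *s xb Q)"
    unfolding phi_sum_xb[OF tan0_external[OF two]] by (rule sum_sum_xb) (simp_all add: nb_external)
  also have "\<dots> = (\<Sum>Q\<in>external_points. (if Q \<in> tan0 then 1 else 0) *s xb Q)"
  proof (rule sum.cong[OF refl])
    fix Q :: "'k point" assume Q: "Q \<in> external_points"
    have "{P \<in> tan0. Q \<in> nb P} = nb Q \<inter> tan0"
      using Q tan0_external[OF two] perp_sym[of Q] by (auto simp: nb_def)
    then show "of_nat (card {P \<in> tan0. Q \<in> nb P}) *s (xb Q :: 'f ^ 'k point) = (if Q \<in> tan0 then 1 else 0) *s xb Q"
      using odd_tan0_nb[OF two Q] by (simp add: of_nat_char_2[OF char_2])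
  qed
  also have "\<dots> = sum_xb tan0" by (rule sum_xb_alt[OF tan0_external[OF two], symmetric])
  finally show ?thesis .
qed

lemma phi_cubed:
  assumes "P \<in> external_points"
  shows "\<phi> (\<phi> (\<phi> (xb P))) = (\<Sum>Q\<in>external_points. of_nat (card (walks P Q)) *s xb Q)"
proof -
  let ?I = "Sigma (nb P) nb"
  have "\<phi> (\<phi> (\<phi> (xb P))) = \<phi> (\<Sum>R\<in>nb P. sum_xb (nb R))"
    by (simp add: phi_xb assms phi_sum_xb nb_external)
  also have "\<dots> = (\<Sum>R\<in>nb P. \<phi> (sum_xb (nb R)))"
    by (rule phi_sum) (simp add: sum_xb_FE nb_external)
  also have "\<dots> = (\<Sum>R\<in>nb P. \<Sum>S\<in>nb R. sum_xb (nb S))"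
    by (simp add: phi_sum_xb nb_external)
  also have "\<dots> = (\<Sum>p\<in>?I. sum_xb (nb (snd p)))"
    by (subst sum.Sigma) (simp_all add: case_prod_unfold)
  also have "\<dots> = (\<Sum>Q\<in>external_points. of_nat (card {p \<in> ?I. Q \<in> nb (snd p)}) *s xb Q)"
    by (rule sum_sum_xb) (rule finite nb_external)+
  also have "\<dots> = (\<Sum>Q\<in>external_points. of_nat (card (walks P Q)) *s xb Q)"
  proof (rule sum.cong[OF refl])
    fix Q :: "'k point" assume Q: "Q \<in> external_points"
    \<comment> \<open>Only the last edge is oriented differently on the two sides; the polarity is
      symmetric.\<close>
    have "{p \<in> ?I. Q \<in> nb (snd p)} = walks P Q"
    proof (intro subset_antisym subsetI)
      fix p assume "p \<in> {p \<in> ?I. Q \<in> nb (snd p)}"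
      then obtain R S where p: "p = (R, S)" "R \<in> nb P" "S \<in> nb R" "Q \<in> perp S" by (auto simp: nb_def)
      have "S \<in> perp Q" using p(4) by (simp only: perp_sym[of S])
      then show "p \<in> walks P Q" using p by (simp add: walks_def nb_def)
    next
      fix p assume "p \<in> walks P Q"
      then obtain R S where p: "p = (R, S)" "R \<in> nb P" "S \<in> nb R" "S \<in> perp Q" by (auto simp: walks_def nb_def)
      have "Q \<in> perp S" using p(4) by (simp only: perp_sym[of Q])
      then show "p \<in> {p \<in> ?I. Q \<in> nb (snd p)}" using p Q by (simp add: nb_def)
    qed
    then show "of_nat (card {p \<in> ?I. Q \<in> nb (snd p)}) *s xb Q
        = (of_nat (card (walks P Q)) *s xb Q :: 'f ^ 'k point)"
      by (simp only:)
  qed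
  finally show ?thesis .
qed

text \<open>The cases are one, two or no vanishing outer coordinates of \<open>w\<close>:
  \<open>Q\<close> in \<open>tan0\<close>, \<open>Q = P0\<close>, or a non-tangent line. The first
  two force \<open>w $ 2\<close> to be nonzero, so \<open>nb P0\<close> contributes nothing
  there.\<close>

lemma card_walks_P0:
  assumes Q: "Q \<in> (external_points :: 'k point set)"
  defines "c \<equiv> of_nat (card (walks P0 (pt (vector [1, 1, 0]) :: 'k point)))"
  shows "(of_nat (card (walks P0 Q)) :: 'f) = (if Q \<in> nb P0 then 1 else 0) + c * (if Q \<in> tan0 then 1 else 0)"
proof -
  obtain w where w: "disc w = 1" "Q = pt w" using external_cases[OF two Q] .
  have nb: "Q \<in> nb P0 \<longleftrightarrow> w $ 2 = 0"
    using Q mem_perp_P0[OF two disc_1_nz[OF w(1)]] by (simp add: nb_def w(2))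
  have tan: "Q \<in> tan0 \<longleftrightarrow> (w $ 1 = 0) \<noteq> (w $ 3 = 0)"
    unfolding w(2) by (rule pt_mem_tan0_iff[OF w(1)])
  consider "Q \<in> tan0" | "w $ 1 = 0" "w $ 3 = 0" | "w $ 1 \<noteq> 0" "w $ 3 \<noteq> 0"
    using tan by blast
  then show ?thesis
  proof cases
    case 1
    then have "w $ 2 \<noteq> 0" using w(1) tan by (auto simp: disc_def)
    then show ?thesis using card_walks_tan0[OF two 1] 1 by (simp add: nb c_def)
  next
    case 2
    then have y: "w $ 2 = 1 \<or> w $ 2 = -1" using w(1) by (simp add: disc_def power2_eq_1_iff)
    have "disc (vector [0, 1, 0] :: 'k ^ 3) = 1" by (simp add: disc_def)
    moreover have "w = vector [0, 1, 0] \<or> w = - vector [0, 1, 0]"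
      unfolding vector_3_eq_iff using 2 y by auto
    ultimately have "Q = P0" unfolding w(2) P0_def using pt_eq_iff_disc_1 w(1) by metis
    then show ?thesis
      using even_walks_refl[OF two P0_external[OF two]] nb y tan 2
      by (auto simp: of_nat_char_2[OF char_2])
  next
    case 3
    then show ?thesis
      using odd_walks[OF two w(1)] nb tan w(2) by (simp add: of_nat_char_2[OF char_2])
  qed
qed

lemma phi_cubed_P0:
  obtains c where "\<phi> (\<phi> (\<phi> (xb P0))) = \<phi> (xb P0) + c *s sum_xb tan0"
proof
  let ?c = "of_nat (card (walks P0 (pt (vector [1, 1, 0]) :: 'k point))) :: 'f"
  have "\<phi> (\<phi> (\<phi> (xb P0))) = (\<Sum>Q\<in>external_points. of_nat (card (walks P0 Q)) *s xb Q)"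
    by (rule phi_cubed[OF P0_external[OF two]])
  also have "\<dots> = (\<Sum>Q\<in>external_points.
      (if Q \<in> nb P0 then 1 else 0) *s xb Q + ?c *s ((if Q \<in> tan0 then 1 else 0) *s xb Q))"
    by (rule sum.cong[OF refl]) (simp only: card_walks_P0 vec.scale_left_distrib vec.scale_scale)
  also have "\<dots> = sum_xb (nb P0) + ?c *s sum_xb tan0"
    unfolding sum_xb_alt[OF nb_external] sum_xb_alt[OF tan0_external[OF two]]
    by (simp only: sum.distrib vec.scale_sum_right)
  also have "sum_xb (nb P0) = \<phi> (xb P0)" by (simp only: phi_xb P0_external[OF two])
  finally show "\<phi> (\<phi> (\<phi> (xb P0))) = \<phi> (xb P0) + ?c *s sum_xb tan0" .
qed

text \<open>Linearity and equivariance reduce this to \<open>P0\<close>. There the fourth and the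
  third iterate contribute the same tangent term, since \<open>phi_tan0\<close> makes it invariant,
  and every summand occurs twice.\<close>

lemma phi_polynomial:
  assumes "u \<in> FE"
  shows "\<phi> (\<phi> (\<phi> (\<phi> u))) + \<phi> (\<phi> (\<phi> u)) + \<phi> (\<phi> u) + \<phi> u = 0" (is "?p u = 0")
  using assms
proof (induction rule: FE_induct)
  case zero
  show ?case by (simp add: phi_0)
next
  case (add u v)
  have "?p (u + v) = ?p u + ?p v" using add.hyps by (simp only: phi_add phi_FE ac_simps)
  with add.IH show ?case by simp
next
  case (scale c u)
  have "?p (c *s u) = c *s ?p u"
    using scale.hyps by (simp only: phi_scale phi_FE vec.scale_right_distrib)
  with scale.IH show ?case by simp
next
  case (xb P)
  obtain h where h: "h \<in> H" "P = pt_act P0 h" using H_transitive[OF two xb] .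
  have e: "(xb P0 :: 'f ^ 'k point) \<in> FE" by (rule xb_FE[OF P0_external[OF two]])
  have t: "(sum_xb tan0 :: 'f ^ 'k point) \<in> FE" by (rule sum_xb_FE[OF tan0_external[OF two]])
  obtain c where c: "\<phi> (\<phi> (\<phi> (xb P0))) = \<phi> (xb P0) + c *s sum_xb tan0" using phi_cubed_P0 .
  have c4: "\<phi> (\<phi> (\<phi> (\<phi> (xb P0)))) = \<phi> (\<phi> (xb P0)) + c *s sum_xb tan0"
    using e t by (simp only: c phi_add phi_scale phi_FE FE_closed phi_tan0)
  have "\<phi> (\<phi> (\<phi> (\<phi> (xb P0)))) + \<phi> (\<phi> (\<phi> (xb P0))) + \<phi> (\<phi> (xb P0)) + \<phi> (xb P0)
     = (\<phi> (\<phi> (xb P0)) + \<phi> (\<phi> (xb P0))) + (\<phi> (xb P0) + \<phi> (xb P0)) + (c *s sum_xb tan0 + c *s sum_xb tan0)"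
    by (subst c4, subst c) (simp only: ac_simps)
  also have "\<dots> = 0" by (simp only: vec_double_char_2[OF char_2] add_0_left)
  finally have P0: "\<phi> (\<phi> (\<phi> (\<phi> (xb P0)))) + \<phi> (\<phi> (\<phi> (xb P0))) + \<phi> (\<phi> (xb P0)) + \<phi> (xb P0) = 0" .
  have xbP: "(xb P :: 'f ^ 'k point) = H_act h (xb P0)" by (simp add: H_act_xb h(2))
  show ?case
    unfolding xbP using P0 e h(1)
    by (simp only: phi_H_act phi_FE H_act_0 flip: H_act_add)
qed

text \<open>In characteristic 2, (X + 1)^3 = X (X^2 + X + 1) + 1, a Bezout relation that writes each
  vector as an image plus a vector killed by the map.\<close>

lemma direct_sum: "FH_direct_sum FE (\<phi> ` FE) {v \<in> FE. \<phi> v = 0}"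
proof -
  have "FH_submodule (\<phi> ` FE)"
    unfolding FH_submodule_def vec.subspace_def
  proof (intro conjI ballI allI)
    show "0 \<in> \<phi> ` FE" using phi_0 FE_closed(1) by (metis imageI)
    show "u + v \<in> \<phi> ` FE" if "u \<in> \<phi> ` FE" "v \<in> \<phi> ` FE" for u v
      using that phi_add FE_closed(2) by (smt (verit) imageE imageI)
    show "c *s u \<in> \<phi> ` FE" if "u \<in> \<phi> ` FE" for c u
      using that phi_scale FE_closed(3) by (smt (verit) imageE imageI)
    show "H_act h u \<in> \<phi> ` FE" if "h \<in> H" "u \<in> \<phi> ` FE" for h u
      using that phi_H_act H_act_FE[OF two that(1)] by (smt (verit) imageE imageI)
  qed
  moreover have "FH_submodule {v \<in> FE. \<phi> v = 0}"
    unfolding FH_submodule_def vec.subspace_def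
    by (auto simp: phi_0 phi_add phi_scale phi_H_act H_act_0 FE_closed H_act_FE[OF two])
  moreover have "FE = {u + w | u w. u \<in> \<phi> ` FE \<and> w \<in> {v \<in> FE. \<phi> v = 0}}"
  proof (intro subset_antisym subsetI)
    fix v :: "'f ^ 'k point" assume v: "v \<in> FE"
    \<comment> \<open>\<open>?u\<close> is the cofactor X^2 + X + 1 applied to \<open>v\<close>, and
      \<open>?w\<close> is (X + 1)^3 applied to \<open>v\<close>.\<close>
    let ?u = "\<phi> (\<phi> v) + \<phi> v + v"
    let ?w = "\<phi> ?u + v"
    have u: "?u \<in> FE" using v by (simp add: phi_FE FE_closed)
    then have w: "?w \<in> FE" using v by (simp add: phi_FE FE_closed)
    have "\<phi> ?w = \<phi> (\<phi> (\<phi> (\<phi> v))) + \<phi> (\<phi> (\<phi> v)) + \<phi> (\<phi> v) + \<phi> v"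
      using v by (simp add: phi_add phi_FE FE_closed)
    then have "\<phi> ?w = 0" using phi_polynomial[OF v] by simp
    moreover have "v = \<phi> ?u + ?w"
      using vec_double_char_2[OF char_2, of "\<phi> ?u"] by (simp add: add.assoc[symmetric])
    ultimately show "v \<in> {u + w | u w. u \<in> \<phi> ` FE \<and> w \<in> {v \<in> FE. \<phi> v = 0}}"
      using u w by blast
  qed (auto simp: phi_FE FE_closed)
  moreover have "\<phi> ` FE \<inter> {v \<in> FE. \<phi> v = 0} = {0}"
  proof -
    \<comment> \<open>As X divides the annihilating polynomial only once, its linear term alone
      survives when the second iterate vanishes.\<close>
    have "\<phi> u = 0" if "u \<in> FE" "\<phi> (\<phi> u) = 0" for u
      using phi_polynomial[OF that(1)] by (simp add: that(2) phi_0)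
    then show ?thesis using phi_0 FE_closed(1) by (auto intro!: image_eqI[of _ _ 0])
  qed
  ultimately show ?thesis unfolding FH_direct_sum_def by blast
qed

end

text \<open>The subfield is closed under addition, so 1 + 1 is 0 or 1, and 1 + 1 = 1 would give 1 =
  0.\<close>

lemma alg_closure_of_F2_char:
  assumes "alg_closure_of_F2 TYPE('f::field)"
  shows "(1::'f) + 1 = 0"
proof -
  interpret algebraic_closure "ring_of_type_algebra :: 'f ring" "{0, 1}"
    using assms by (simp add: alg_closure_of_F2_def)
  have "(1::'f) + 1 \<in> {0, 1}"
    using subcringE(7)[OF subfieldE(2)[OF subfield_axioms], of 1 1]
    by (simp add: ring_of_type_algebra_def)
  then show ?thesis by (metis add_cancel_right_right insertE singletonD zero_neq_one)
qed

theorem proposition5p2: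
  fixes q :: nat
    and \<phi> :: "'f::field ^ 'k::finite_field point \<Rightarrow> 'f ^ 'k point"
  assumes "CARD('k) = q" and "odd q"
    and "alg_closure_of_F2 TYPE('f)"
    and "FH_hom FE FE \<phi>"
    and "\<And>P. P \<in> external_points \<Longrightarrow> \<phi> (xb P) = (\<Sum>Q\<in>perp P \<inter> external_points. xb Q)"
  shows "FH_direct_sum FE (\<phi> ` FE) {v \<in> FE. \<phi> v = 0}"
proof -
  interpret polarity_map \<phi>
    using assms two_neq_0 alg_closure_of_F2_char
    by unfold_locales (auto simp: sum_xb_def nb_def)
  show ?thesis by (rule direct_sum)
qed

end
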